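(* Let $\mathcal{A}=A\oplus P$ be a diolic algebra over $\mathbb{K}$, $k\geq 1$, and let $\varsigma:\mathrm{Diff}_k(\mathcal{A})_0\to\mathrm{Diff}_k(A)$ be the projection sending a degree $0$ graded differential operator $\Box_0=(\Box_0^A,\Box_0^P)$ to its component $\Box_0^A$. Then there is an isomorphism of $A$-modules $\ker(\varsigma)\cong\mathrm{Diff}_{k-1}(P,P)$.
   Context: $\mathbb{K}$ is a field of characteristic $0$. A diolic algebra is a $\mathbb{Z}$-graded commutative $\mathbb{K}$-algebra $\mathcal{A}=\mathcal{A}_0\oplus\mathcal{A}_1$ with $\mathcal{A}_0=A$ a commutative unital $\mathbb{K}$-algebra, $\mathcal{A}_1=P$ an $A$-module, $\mathcal{A}_i=0$ for $i\ne 0,1$; the products are the multiplication of $A$, the module action $A\cdot P\subseteq P$, and $P\cdot P=0$. For a homogeneous $\mathbb{K}$-linear map $\varphi:\mathcal{A}\to\mathcal{A}$ and homogeneous $a\in\mathcal{A}$ put $\delta_a\varphi:=a\circ\varphi-(-1)^{\deg a\,\deg\varphi}\varphi\circ a$, where $a$ also denotes multiplication by $a$. $\varphi$ is a graded differential operator of order $\leq k$ if $\delta_{a_0}\circ\cdots\circ\delta_{a_k}(\varphi)=0$ for all homogeneous $a_0,\dots,a_k\in\mathcal{A}$; those of degree $0$ form $\mathrm{Diff}_k(\mathcal{A})_0$. $\mathrm{Diff}_k(Q,R)$ for $A$-modules $Q,R$ is the module of ordinary differential operators of order $\leq k$ over $A$ (same definition, with $a_i\in A$), and $\mathrm{Diff}_k(A)=\mathrm{Diff}_k(A,A)$.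 $\Box_0^A,\Box_0^P$ denote the restrictions of $\Box_0$ to $A$ and $P$. *)

theory Defs
  imports "HOL-Algebra.Module" "HOL-Algebra.AbelCoset"
begin

section \<open>Linear maps and isomorphisms of modules\<close>

definition char_zero :: "('k, 'm) ring_scheme \<Rightarrow> bool" where
  "char_zero K \<longleftrightarrow> (\<forall>n::nat. 0 < n \<longrightarrow> [n] \<cdot>\<^bsub>K\<^esub> \<one>\<^bsub>K\<^esub> \<noteq> \<zero>\<^bsub>K\<^esub>)"

definition is_linear ::
  "('r, 'm) ring_scheme \<Rightarrow> ('r, 'a, 'n) module_scheme \<Rightarrow> ('r, 'b, 'l) module_scheme \<Rightarrow> ('a \<Rightarrow> 'b) \<Rightarrow> bool"
  where "is_linear R M N f \<longleftrightarrow>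
     f \<in> carrier M \<rightarrow> carrier N \<and>
     (\<forall>x\<in>carrier M. \<forall>y\<in>carrier M. f (x \<oplus>\<^bsub>M\<^esub> y) = f x \<oplus>\<^bsub>N\<^esub> f y) \<and>
     (\<forall>c\<in>carrier R. \<forall>x\<in>carrier M. f (c \<odot>\<^bsub>M\<^esub> x) = c \<odot>\<^bsub>N\<^esub> f x)"

definition module_isomorphic ::
  "('r, 'm) ring_scheme \<Rightarrow> ('r, 'a, 'n) module_scheme \<Rightarrow> ('r, 'b, 'l) module_scheme \<Rightarrow> bool"
  where "module_isomorphic R M N \<longleftrightarrow>
     module R M \<and> module R N \<and>
     (\<exists>h. is_linear R M N h \<and> bij_betw h (carrier M) (carrier N))"

text \<open>
  Sets of maps below consist of functions that are extensional on the carrier of their domain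
  (\<open>undefined\<close> outside), so that equality of functions is equality of maps.
\<close>

definition linear_maps ::
  "('r, 'm) ring_scheme \<Rightarrow> ('r, 'a, 'n) module_scheme \<Rightarrow> ('r, 'b, 'l) module_scheme \<Rightarrow> ('a \<Rightarrow> 'b) set"
  where "linear_maps R M N = {f \<in> extensional (carrier M). is_linear R M N f}"

definition self_module :: "('a, 'm) ring_scheme \<Rightarrow> ('a, 'a) module" where
  "self_module A = \<lparr>carrier = carrier A, mult = mult A, one = one A,
     zero = zero A, add = add A, smult = mult A\<rparr>"

definition restrict_scalars ::
  "('k, 'a, 'm) module_scheme \<Rightarrow> ('a, 'q, 'n) module_scheme \<Rightarrow> ('k, 'q) module" where
  "restrict_scalars A Q = \<lparr>carrier = carrier Q, mult = mult Q, one = one Q,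
     zero = zero Q, add = add Q, smult = (\<lambda>c q. (c \<odot>\<^bsub>A\<^esub> \<one>\<^bsub>A\<^esub>) \<odot>\<^bsub>Q\<^esub> q)\<rparr>"


section \<open>Differential operators between modules\<close>

definition delta ::
  "('a, 'q, 'm) module_scheme \<Rightarrow> ('a, 'r, 'n) module_scheme \<Rightarrow> 'a \<Rightarrow> ('q \<Rightarrow> 'r) \<Rightarrow> ('q \<Rightarrow> 'r)" where
  "delta Q R a \<phi> = (\<lambda>x\<in>carrier Q. a \<odot>\<^bsub>R\<^esub> \<phi> x \<ominus>\<^bsub>R\<^esub> \<phi> (a \<odot>\<^bsub>Q\<^esub> x))"

text \<open>For \<open>as = [a\<^sub>0, \<dots>, a\<^sub>k]\<close>, \<open>foldr (delta Q R) as \<phi>\<close> is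
  \<open>(\<delta>\<^bsub>a\<^sub>0\<^esub> \<circ> \<dots> \<circ> \<delta>\<^bsub>a\<^sub>k\<^esub>) \<phi>\<close>.\<close>

definition Diff ::
  "('k, 'm) ring_scheme \<Rightarrow> ('k, 'a, 'n) module_scheme \<Rightarrow> nat \<Rightarrow>
   ('a, 'q, 'l) module_scheme \<Rightarrow> ('a, 'r, 'o) module_scheme \<Rightarrow> ('q \<Rightarrow> 'r) set" where
  "Diff K A k Q R =
     {\<phi> \<in> linear_maps K (restrict_scalars A Q) (restrict_scalars A R).
        \<forall>as. length as = Suc k \<and> set as \<subseteq> carrier A \<longrightarrow>
          (\<forall>x\<in>carrier Q. foldr (delta Q R) as \<phi> x = \<zero>\<^bsub>R\<^esub>)}"

text \<open>The \<open>A\<close>-module structure is the left one, \<open>(a \<cdot> \<phi>)(x) = a \<cdot> \<phi>(x)\<close>.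
  The multiplicative fields of a module record play no role.\<close>

definition Diff_module ::
  "('k, 'm) ring_scheme \<Rightarrow> ('k, 'a, 'n) module_scheme \<Rightarrow> nat \<Rightarrow>
   ('a, 'q, 'l) module_scheme \<Rightarrow> ('a, 'r, 'o) module_scheme \<Rightarrow> ('a, 'q \<Rightarrow> 'r) module" where
  "Diff_module K A k Q R = \<lparr>carrier = Diff K A k Q R, mult = undefined, one = undefined,
     zero = (\<lambda>x\<in>carrier Q. \<zero>\<^bsub>R\<^esub>),
     add = (\<lambda>\<phi> \<psi>. \<lambda>x\<in>carrier Q. \<phi> x \<oplus>\<^bsub>R\<^esub> \<psi> x),
     smult = (\<lambda>a \<phi>. \<lambda>x\<in>carrier Q. a \<odot>\<^bsub>R\<^esub> \<phi> x)\<rparr>"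


section \<open>Graded differential operators\<close>

text \<open>A grading of an algebra is given by the family of its homogeneous components.\<close>

definition graded_delta ::
  "('r, 'm) ring_scheme \<Rightarrow> int \<Rightarrow> int \<Rightarrow> 'r \<Rightarrow> ('r \<Rightarrow> 'r) \<Rightarrow> ('r \<Rightarrow> 'r)" where
  "graded_delta R i d a \<phi> = (\<lambda>x\<in>carrier R.
     if even (i * d) then a \<otimes>\<^bsub>R\<^esub> \<phi> x \<ominus>\<^bsub>R\<^esub> \<phi> (a \<otimes>\<^bsub>R\<^esub> x)
     else a \<otimes>\<^bsub>R\<^esub> \<phi> x \<oplus>\<^bsub>R\<^esub> \<phi> (a \<otimes>\<^bsub>R\<^esub> x))"

text \<open>
  The degrees \<open>i\<close> of \<open>a\<close> and \<open>d\<close> of \<open>\<phi>\<close> are passed explicitly. The composite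
  \<open>(\<delta>\<^bsub>a\<^sub>0\<^esub> \<circ> \<dots> \<circ> \<delta>\<^bsub>a\<^sub>k\<^esub>) \<phi>\<close> takes the list of the pairs
  \<open>(deg a\<^sub>j, a\<^sub>j)\<close>; applying \<open>\<delta>\<^bsub>a\<^esub>\<close> raises the degree of a map by the degree of \<open>a\<close>.
\<close>

fun graded_deltas ::
  "('r, 'm) ring_scheme \<Rightarrow> int \<Rightarrow> (int \<times> 'r) list \<Rightarrow> ('r \<Rightarrow> 'r) \<Rightarrow> ('r \<Rightarrow> 'r)" where
  "graded_deltas R d [] \<phi> = \<phi>"
| "graded_deltas R d ((i, a) # as) \<phi> =
     graded_delta R i (d + sum_list (map fst as)) a (graded_deltas R d as \<phi>)"

definition graded_maps ::
  "('k, 'm) ring_scheme \<Rightarrow> ('k, 'r, 'n) module_scheme \<Rightarrow> (int \<Rightarrow> 'r set) \<Rightarrow> int \<Rightarrow> ('r \<Rightarrow> 'r) set" where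
  "graded_maps K R G d = {\<phi> \<in> linear_maps K R R. \<forall>i. \<phi> ` G i \<subseteq> G (i + d)}"

definition graded_Diff ::
  "('k, 'm) ring_scheme \<Rightarrow> ('k, 'r, 'n) module_scheme \<Rightarrow> (int \<Rightarrow> 'r set) \<Rightarrow> nat \<Rightarrow> int \<Rightarrow> ('r \<Rightarrow> 'r) set"
  where
  "graded_Diff K R G k d =
     {\<phi> \<in> graded_maps K R G d.
        \<forall>as. length as = Suc k \<and> (\<forall>(i, a)\<in>set as. a \<in> G i) \<longrightarrow>
          (\<forall>x\<in>carrier R. graded_deltas R d as \<phi> x = \<zero>\<^bsub>R\<^esub>)}"


section \<open>Diolic algebras\<close>

definition diolic ::
  "('k, 'a, 'm) module_scheme \<Rightarrow> ('a, 'p, 'n) module_scheme \<Rightarrow> ('k, 'a \<times> 'p) module" where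
  "diolic A P = \<lparr>carrier = carrier A \<times> carrier P,
     mult = (\<lambda>(a, p) (b, q). (a \<otimes>\<^bsub>A\<^esub> b, a \<odot>\<^bsub>P\<^esub> q \<oplus>\<^bsub>P\<^esub> b \<odot>\<^bsub>P\<^esub> p)),
     one = (\<one>\<^bsub>A\<^esub>, \<zero>\<^bsub>P\<^esub>),
     zero = (\<zero>\<^bsub>A\<^esub>, \<zero>\<^bsub>P\<^esub>),
     add = (\<lambda>(a, p) (b, q). (a \<oplus>\<^bsub>A\<^esub> b, p \<oplus>\<^bsub>P\<^esub> q)),
     smult = (\<lambda>c (a, p). (c \<odot>\<^bsub>A\<^esub> a, (c \<odot>\<^bsub>A\<^esub> \<one>\<^bsub>A\<^esub>) \<odot>\<^bsub>P\<^esub> p))\<rparr>"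

definition diolic_grading ::
  "('k, 'a, 'm) module_scheme \<Rightarrow> ('a, 'p, 'n) module_scheme \<Rightarrow> int \<Rightarrow> ('a \<times> 'p) set" where
  "diolic_grading A P i =
     (if i = 0 then carrier A \<times> {\<zero>\<^bsub>P\<^esub>}
      else if i = 1 then {\<zero>\<^bsub>A\<^esub>} \<times> carrier P
      else {(\<zero>\<^bsub>A\<^esub>, \<zero>\<^bsub>P\<^esub>)})"

definition diolic_Diff0 ::
  "('k, 'm) ring_scheme \<Rightarrow> ('k, 'a, 'n) module_scheme \<Rightarrow> ('a, 'p, 'l) module_scheme \<Rightarrow> nat \<Rightarrow>
   ('a, 'a \<times> 'p \<Rightarrow> 'a \<times> 'p) module" where
  "diolic_Diff0 K A P k =
     \<lparr>carrier = graded_Diff K (diolic A P) (diolic_grading A P) k 0,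
      mult = undefined, one = undefined,
      zero = (\<lambda>x\<in>carrier (diolic A P). \<zero>\<^bsub>diolic A P\<^esub>),
      add = (\<lambda>\<phi> \<psi>. \<lambda>x\<in>carrier (diolic A P). \<phi> x \<oplus>\<^bsub>diolic A P\<^esub> \<psi> x),
      smult = (\<lambda>a \<phi>. \<lambda>x\<in>carrier (diolic A P). (a, \<zero>\<^bsub>P\<^esub>) \<otimes>\<^bsub>diolic A P\<^esub> \<phi> x)\<rparr>"

definition varsigma ::
  "('k, 'a, 'm) module_scheme \<Rightarrow> ('a, 'p, 'n) module_scheme \<Rightarrow> ('a \<times> 'p \<Rightarrow> 'a \<times> 'p) \<Rightarrow> ('a \<Rightarrow> 'a)" where
  "varsigma A P \<phi> = (\<lambda>a\<in>carrier A. fst (\<phi> (a, \<zero>\<^bsub>P\<^esub>)))"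

definition ker_varsigma ::
  "('k, 'm) ring_scheme \<Rightarrow> ('k, 'a, 'n) module_scheme \<Rightarrow> ('a, 'p, 'l) module_scheme \<Rightarrow> nat \<Rightarrow>
   ('a, 'a \<times> 'p \<Rightarrow> 'a \<times> 'p) module" where
  "ker_varsigma K A P k = (diolic_Diff0 K A P k)
     \<lparr>carrier := a_kernel (diolic_Diff0 K A P k)
        (Diff_module K A k (self_module A) (self_module A)) (varsigma A P)\<rparr>"


section \<open>Consistency of the definitions\<close>

lemma self_module: fixes A (structure) assumes "cring A" shows "module A (self_module A)"
proof -
  interpret cring A by fact
  have "abelian_group (self_module A)"
    by (rule abelian_groupI) (auto simp: self_module_def a_assoc intro: a_comm l_neg a_inv_closed add.l_inv_ex)
  then show ?thesis
    by (intro moduleI) (auto simp: self_module_def l_distr r_distr m_assoc is_cring)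
qed

context
  fixes K :: "('k, 'm) ring_scheme" and A :: "('k, 'a, 'n) module_scheme"
    and P :: "('a, 'p, 'l) module_scheme"
  assumes KA: "algebra K A" and AP: "module A P"
begin

interpretation A: cring A using KA by (rule algebra.M_cring)
interpretation KA: algebra K A by (rule KA)
interpretation P: abelian_group P using AP unfolding module_def by simp
interpretation AP: module A P by (rule AP)

lemma diolic_algebra: "algebra K (diolic A P)"
proof -
  have g: "abelian_group (diolic A P)"
  proof (rule abelian_groupI)
    fix x assume "x \<in> carrier (diolic A P)"
    then show "\<exists>y\<in>carrier (diolic A P). y \<oplus>\<^bsub>diolic A P\<^esub> x = \<zero>\<^bsub>diolic A P\<^esub>"
      by (intro bexI[of _ "(\<ominus>\<^bsub>A\<^esub> fst x, \<ominus>\<^bsub>P\<^esub> snd x)"])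
        (auto simp: diolic_def A.l_neg P.l_neg)
  qed (auto simp: diolic_def A.a_ac P.a_ac)
  have m: "comm_monoid (diolic A P)"
    by (rule comm_monoidI)
      (auto simp: diolic_def A.l_distr A.r_distr AP.smult_l_distr AP.smult_r_distr
        AP.smult_assoc1[symmetric] A.m_ac P.a_ac)
  have c: "cring (diolic A P)"
    by (rule cringI[OF g m])
      (auto simp: diolic_def A.l_distr AP.smult_l_distr AP.smult_r_distr P.a_ac)
  have 2: "(c \<odot>\<^bsub>A\<^esub> \<one>\<^bsub>A\<^esub>) \<odot>\<^bsub>P\<^esub> (a \<odot>\<^bsub>P\<^esub> p) = (c \<odot>\<^bsub>A\<^esub> a) \<odot>\<^bsub>P\<^esub> p"
    and 3: "a \<odot>\<^bsub>P\<^esub> ((c \<odot>\<^bsub>A\<^esub> \<one>\<^bsub>A\<^esub>) \<odot>\<^bsub>P\<^esub> p) = (c \<odot>\<^bsub>A\<^esub> a) \<odot>\<^bsub>P\<^esub> p"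
    if "c \<in> carrier K" "a \<in> carrier A" "p \<in> carrier P" for c a p
    using that by (simp_all add: AP.smult_assoc1[symmetric] KA.smult_assoc2 A.m_comm[of a "c \<odot>\<^bsub>A\<^esub> \<one>\<^bsub>A\<^esub>"])
  have 4: "c \<odot>\<^bsub>A\<^esub> (d \<odot>\<^bsub>A\<^esub> \<one>\<^bsub>A\<^esub>) = d \<odot>\<^bsub>A\<^esub> (c \<odot>\<^bsub>A\<^esub> \<one>\<^bsub>A\<^esub>)"
    if "c \<in> carrier K" "d \<in> carrier K" for c d
    using that by (simp add: KA.smult_assoc1[symmetric] KA.R.m_comm)
  show ?thesis
    by (rule algebraI)
      (use c KA.R_cring in \<open>auto simp: diolic_def KA.smult_l_distr KA.smult_r_distr KA.smult_assoc1
        KA.smult_assoc2 AP.smult_l_distr AP.smult_r_distr 2 3 4\<close>)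
qed

lemma diolic_grading_decomp:
  assumes "x \<in> carrier (diolic A P)"
  shows "\<exists>!(y, z). y \<in> diolic_grading A P 0 \<and> z \<in> diolic_grading A P 1 \<and> x = y \<oplus>\<^bsub>diolic A P\<^esub> z"
proof -
  obtain a p where x: "x = (a, p)" "a \<in> carrier A" "p \<in> carrier P"
    using assms by (auto simp: diolic_def)
  show ?thesis
  proof (rule ex1I[of _ "((a, \<zero>\<^bsub>P\<^esub>), (\<zero>\<^bsub>A\<^esub>, p))"])
    show "case ((a, \<zero>\<^bsub>P\<^esub>), (\<zero>\<^bsub>A\<^esub>, p)) of (y, z) \<Rightarrow>
        y \<in> diolic_grading A P 0 \<and> z \<in> diolic_grading A P 1 \<and> x = y \<oplus>\<^bsub>diolic A P\<^esub> z"
      using x by (simp add: diolic_def diolic_grading_def)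
  next
    fix w
    assume "case w of (y, z) \<Rightarrow>
        y \<in> diolic_grading A P 0 \<and> z \<in> diolic_grading A P 1 \<and> x = y \<oplus>\<^bsub>diolic A P\<^esub> z"
    then show "w = ((a, \<zero>\<^bsub>P\<^esub>), (\<zero>\<^bsub>A\<^esub>, p))"
      using x(1) by (cases w) (auto simp: diolic_def diolic_grading_def)
  qed
qed

lemma diolic_graded_comm:
  assumes "x \<in> diolic_grading A P i" "y \<in> diolic_grading A P j"
  shows "y \<otimes>\<^bsub>diolic A P\<^esub> x =
    (if even (i * j) then x \<otimes>\<^bsub>diolic A P\<^esub> y else \<ominus>\<^bsub>diolic A P\<^esub> (x \<otimes>\<^bsub>diolic A P\<^esub> y))"
proof -
  interpret D: algebra K "diolic A P" by (rule diolic_algebra)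
  have sub: "x \<in> carrier (diolic A P)" "y \<in> carrier (diolic A P)"
    using assms by (auto simp: diolic_def diolic_grading_def split: if_splits)
  show ?thesis
  proof (cases "even (i * j)")
    case True
    then show ?thesis using sub D.m_comm by simp
  next
    case False
    then have "x \<otimes>\<^bsub>diolic A P\<^esub> y = \<zero>\<^bsub>diolic A P\<^esub>" 
      using assms by (auto simp: diolic_def diolic_grading_def split: if_splits)
    then show ?thesis using sub D.m_comm by simp
  qed
qed

lemma degree_0_deltas:
  assumes \<phi>: "\<phi> \<in> graded_maps K (diolic A P) (diolic_grading A P) 0"
    and as: "set as \<subseteq> carrier A"
  shows "a \<in> carrier A \<Longrightarrow> graded_deltas (diolic A P) 0 (map (\<lambda>a. (0, (a, \<zero>\<^bsub>P\<^esub>))) as) \<phi> (a, \<zero>\<^bsub>P\<^esub>) =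
      (foldr (delta (self_module A) (self_module A)) as (varsigma A P \<phi>) a, \<zero>\<^bsub>P\<^esub>)
    \<and> foldr (delta (self_module A) (self_module A)) as (varsigma A P \<phi>) a \<in> carrier A"
  using as
proof (induction as arbitrary: a)
  case Nil
  have "(a, \<zero>\<^bsub>P\<^esub>) \<in> diolic_grading A P 0" using Nil by (simp add: diolic_grading_def)
  then have "\<phi> (a, \<zero>\<^bsub>P\<^esub>) \<in> diolic_grading A P 0" using \<phi> unfolding graded_maps_def by force
  then show ?case using Nil by (auto simp: varsigma_def diolic_grading_def)
next
  case (Cons b as)
  let ?D = "diolic A P"
  interpret D: algebra K "diolic A P" by (rule diolic_algebra)
  let ?f = "foldr (delta (self_module A) (self_module A)) as (varsigma A P \<phi>)"
  have b: "b \<in> carrier A" "b \<otimes>\<^bsub>A\<^esub> a \<in> carrier A" "set as \<subseteq> carrier A" using Cons by auto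
  have s: "\<ominus>\<^bsub>self_module A\<^esub> x = \<ominus>\<^bsub>A\<^esub> x" for x
    by (simp add: a_inv_def self_module_def m_inv_def)
  have m: "\<ominus>\<^bsub>?D\<^esub> (x, \<zero>\<^bsub>P\<^esub>) = (\<ominus>\<^bsub>A\<^esub> x, \<zero>\<^bsub>P\<^esub>)" if "x \<in> carrier A" for x
    using that by (intro D.minus_equality) (auto simp: diolic_def A.l_neg)
  note IH = Cons.IH[OF Cons.prems(1) b(3)] Cons.IH[OF b(2) b(3)]
  have q: "(b, \<zero>\<^bsub>P\<^esub>) \<otimes>\<^bsub>?D\<^esub> (x, \<zero>\<^bsub>P\<^esub>) = (b \<otimes>\<^bsub>A\<^esub> x, \<zero>\<^bsub>P\<^esub>)" if "x \<in> carrier A" for x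
    using that b by (simp add: diolic_def)
  have t: "(x, \<zero>\<^bsub>P\<^esub>) \<oplus>\<^bsub>?D\<^esub> (y, \<zero>\<^bsub>P\<^esub>) = (x \<oplus>\<^bsub>A\<^esub> y, \<zero>\<^bsub>P\<^esub>)" for x y
    by (simp add: diolic_def)
  have c: "(x, \<zero>\<^bsub>P\<^esub>) \<in> carrier ?D \<longleftrightarrow> x \<in> carrier A" for x
    by (simp add: diolic_def)
  have d: "delta (self_module A) (self_module A) b ?f a = b \<otimes>\<^bsub>A\<^esub> ?f a \<ominus>\<^bsub>A\<^esub> ?f (b \<otimes>\<^bsub>A\<^esub> a)"
    using Cons.prems by (simp add: delta_def a_minus_def s) (simp add: self_module_def)
  show ?case
    using IH Cons.prems b by (simp add: graded_delta_def a_minus_def q t m c d)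
qed

lemma varsigma_Diff:
  assumes "\<phi> \<in> graded_Diff K (diolic A P) (diolic_grading A P) k 0"
  shows "varsigma A P \<phi> \<in> Diff K A k (self_module A) (self_module A)"
proof -
  have \<phi>: "\<phi> \<in> graded_maps K (diolic A P) (diolic_grading A P) 0"
    using assms by (simp add: graded_Diff_def)
  then have lin: "is_linear K (diolic A P) (diolic A P) \<phi>"
    by (simp add: graded_maps_def linear_maps_def)
  note c = degree_0_deltas[OF \<phi>, of "[]", simplified]
  have cl: "varsigma A P \<phi> x \<in> carrier A" if "x \<in> carrier A" for x
    using c[OF that] by simp
  have ext: "varsigma A P \<phi> \<in> extensional (carrier A)"
    by (simp add: varsigma_def)
  have in_D: "(x, \<zero>\<^bsub>P\<^esub>) \<in> carrier (diolic A P)" if "x \<in> carrier A" for x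
    using that by (simp add: diolic_def)
  have "varsigma A P \<phi> (x \<oplus>\<^bsub>A\<^esub> y) = varsigma A P \<phi> x \<oplus>\<^bsub>A\<^esub> varsigma A P \<phi> y"
    if "x \<in> carrier A" "y \<in> carrier A" for x y
  proof -
    have "\<phi> ((x, \<zero>\<^bsub>P\<^esub>) \<oplus>\<^bsub>diolic A P\<^esub> (y, \<zero>\<^bsub>P\<^esub>)) = \<phi> (x, \<zero>\<^bsub>P\<^esub>) \<oplus>\<^bsub>diolic A P\<^esub> \<phi> (y, \<zero>\<^bsub>P\<^esub>)"
      using lin in_D[OF that(1)] in_D[OF that(2)] unfolding is_linear_def by blast
    then show ?thesis using that c by (simp add: diolic_def)
  qed
  moreover have "varsigma A P \<phi> ((r \<odot>\<^bsub>A\<^esub> \<one>\<^bsub>A\<^esub>) \<otimes>\<^bsub>A\<^esub> x) = (r \<odot>\<^bsub>A\<^esub> \<one>\<^bsub>A\<^esub>) \<otimes>\<^bsub>A\<^esub> varsigma A P \<phi> x"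
    if "x \<in> carrier A" "r \<in> carrier K" for x r
  proof -
    have "\<phi> (r \<odot>\<^bsub>diolic A P\<^esub> (x, \<zero>\<^bsub>P\<^esub>)) = r \<odot>\<^bsub>diolic A P\<^esub> \<phi> (x, \<zero>\<^bsub>P\<^esub>)"
      using lin in_D[OF that(1)] that(2) unfolding is_linear_def by blast
    then show ?thesis using that c[of x] c[of "r \<odot>\<^bsub>A\<^esub> x"] by (simp add: diolic_def KA.smult_assoc2)
  qed
  ultimately have "varsigma A P \<phi> \<in> linear_maps K (restrict_scalars A (self_module A)) (restrict_scalars A (self_module A))"
    using cl ext by (simp add: linear_maps_def is_linear_def restrict_scalars_def self_module_def Pi_def)
  moreover have "foldr (delta (self_module A) (self_module A)) as (varsigma A P \<phi>) x = \<zero>\<^bsub>A\<^esub>"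
    if "length as = Suc k" "set as \<subseteq> carrier A" "x \<in> carrier A" for as x
  proof -
    have "graded_deltas (diolic A P) 0 (map (\<lambda>a. (0, (a, \<zero>\<^bsub>P\<^esub>))) as) \<phi> (x, \<zero>\<^bsub>P\<^esub>) = \<zero>\<^bsub>diolic A P\<^esub>"
    proof -
      have "\<forall>(i, a)\<in>set (map (\<lambda>a. (0, (a, \<zero>\<^bsub>P\<^esub>))) as). a \<in> diolic_grading A P i"
        using that by (auto simp: diolic_grading_def)
      moreover have "(x, \<zero>\<^bsub>P\<^esub>) \<in> carrier (diolic A P)" using that by (simp add: diolic_def)
      moreover have "length (map (\<lambda>a. (0::int, (a, \<zero>\<^bsub>P\<^esub>))) as) = Suc k" using that by simp
      ultimately show ?thesis using assms unfolding graded_Diff_def by blast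
    qed
    then show ?thesis using degree_0_deltas[OF \<phi> that(2,3)] by (simp add: diolic_def)
  qed
  ultimately show ?thesis by (simp add: Diff_def self_module_def)
qed

lemma diolic_grading_mult:
  assumes "x \<in> diolic_grading A P i" "y \<in> diolic_grading A P j"
  shows "x \<otimes>\<^bsub>diolic A P\<^esub> y \<in> diolic_grading A P (i + j)"
  using assms by (auto simp: diolic_def diolic_grading_def split: if_splits)

end
end

theory Submission
  imports Defs
begin

text \<open>
  A graded map of degree \<open>0\<close> preserves both \<open>A\<close> and \<open>P\<close>, so an element of \<open>ker \<varsigma>\<close> is
  \<open>(a, p) \<mapsto> (0, \<psi> p)\<close> for a unique \<open>K\<close>-linear \<open>\<psi> : P \<rightarrow> P\<close>. The isomorphism sends \<open>\<psi>\<close> to this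
  map, and the whole content is how the orders compare: the map has graded order \<open>\<le> k\<close> on
  \<open>A \<oplus> P\<close> exactly if \<open>\<psi>\<close> has order \<open>\<le> k - 1\<close> on \<open>P\<close>.

  The shift by one comes from the commutators with elements of degree \<open>1\<close>. Commuting with
  \<open>b \<in> A\<close> replaces \<open>\<psi>\<close> by \<open>\<delta>\<^sub>b \<psi>\<close>. Commuting with \<open>p \<in> P\<close> gives the map \<open>a \<mapsto> - \<psi> (a p)\<close> from
  \<open>A\<close> to \<open>P\<close>, because \<open>\<psi>\<close> is extended by \<open>0\<close> to \<open>A\<close>. Further commutators with elements of \<open>A\<close>
  act on this map again through \<open>\<psi>\<close>, and a second commutator with an element of \<open>P\<close> kills it,
  since the result raises degrees by \<open>2\<close> and only the degrees \<open>0\<close> and \<open>1\<close> are occupied.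

  If the graded order is \<open>\<le> k\<close>, take \<open>p\<close> innermost and \<open>k\<close> elements of \<open>A\<close> outside, and
  evaluate at \<open>1 \<in> A\<close>: this says \<open>(\<delta>\<^bsub>b1\<^esub> \<dots> \<delta>\<^bsub>bk\<^esub> \<psi>) p = 0\<close> for every \<open>p\<close>, so \<open>\<psi>\<close> has order
  \<open>\<le> k - 1\<close>. Conversely, among \<open>k + 1\<close> homogeneous elements at most one has degree \<open>1\<close> unless
  the commutator vanishes anyway, so at least \<open>k\<close> of them act on \<open>\<psi>\<close> as \<open>\<delta>\<^sub>b\<close> with \<open>b \<in> A\<close>. Both
  directions meet in \<open>module_part_map_graded_Diff_iff\<close>.
\<close>


section \<open>Transport of module structures\<close>

text \<open>
  Only one side has to be known to be a module: a bijection compatible with the operations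
  carries the module laws over. This makes \<open>ker \<varsigma>\<close> a module without a separate treatment of
  graded operators.
\<close>

lemma module_isomorphic_if_bij:
  assumes N: "module R N" and bij: "bij_betw h (carrier N) (carrier M)"
    and add: "\<And>x y. x \<in> carrier N \<Longrightarrow> y \<in> carrier N \<Longrightarrow> h (x \<oplus>\<^bsub>N\<^esub> y) = h x \<oplus>\<^bsub>M\<^esub> h y"
    and smult: "\<And>c x. c \<in> carrier R \<Longrightarrow> x \<in> carrier N \<Longrightarrow> h (c \<odot>\<^bsub>N\<^esub> x) = c \<odot>\<^bsub>M\<^esub> h x"
    and zero: "h \<zero>\<^bsub>N\<^esub> = \<zero>\<^bsub>M\<^esub>"
  shows "module_isomorphic R M N"
proof -
  interpret N: module R N by fact
  have M: "carrier M = h ` carrier N"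
    using bij by (simp add: bij_betw_def)
  note h = add[symmetric] smult[symmetric] zero[symmetric]
  have g: "abelian_group M"
  proof (rule abelian_groupI)
    fix x assume "x \<in> carrier M"
    then obtain u where u: "u \<in> carrier N" "x = h u" by (auto simp: M)
    then show "\<exists>y\<in>carrier M. y \<oplus>\<^bsub>M\<^esub> x = \<zero>\<^bsub>M\<^esub>"
      by (intro bexI[of _ "h (\<ominus>\<^bsub>N\<^esub> u)"]) (auto simp: M h N.l_neg)
  qed (auto simp: M h N.a_ac)
  have mod: "module R M"
    by (rule moduleI[OF N.R.is_cring g])
      (auto simp: M h N.smult_l_distr N.smult_r_distr N.smult_assoc1)
  let ?g = "the_inv_into (carrier N) h"
  have inv: "?g (h u) = u" if "u \<in> carrier N" for u
    using that bij by (simp add: bij_betw_def the_inv_into_f_f)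
  have "is_linear R M N ?g"
    by (auto simp: is_linear_def M h inv)
  moreover have "bij_betw ?g (carrier M) (carrier N)"
    by (rule bij_betw_the_inv_into[OF bij])
  ultimately show ?thesis
    using N mod by (auto simp: module_isomorphic_def)
qed


section \<open>The module of differential operators\<close>

lemma linear_maps_restrict_scalars_iff:
  "\<phi> \<in> linear_maps K (restrict_scalars A Q) (restrict_scalars A R) \<longleftrightarrow>
     \<phi> \<in> extensional (carrier Q) \<and> \<phi> \<in> carrier Q \<rightarrow> carrier R \<and>
     (\<forall>x\<in>carrier Q. \<forall>y\<in>carrier Q. \<phi> (x \<oplus>\<^bsub>Q\<^esub> y) = \<phi> x \<oplus>\<^bsub>R\<^esub> \<phi> y) \<and>
     (\<forall>c\<in>carrier K. \<forall>x\<in>carrier Q.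
        \<phi> ((c \<odot>\<^bsub>A\<^esub> \<one>\<^bsub>A\<^esub>) \<odot>\<^bsub>Q\<^esub> x) = (c \<odot>\<^bsub>A\<^esub> \<one>\<^bsub>A\<^esub>) \<odot>\<^bsub>R\<^esub> \<phi> x)"
  by (simp add: linear_maps_def is_linear_def restrict_scalars_def)

lemma delta_apply:
  "x \<in> carrier Q \<Longrightarrow> delta Q R a \<phi> x = a \<odot>\<^bsub>R\<^esub> \<phi> x \<ominus>\<^bsub>R\<^esub> \<phi> (a \<odot>\<^bsub>Q\<^esub> x)"
  by (simp add: delta_def)

context
  fixes K :: "('k, 'm) ring_scheme" and A :: "('k, 'a, 'n) module_scheme"
    and Q :: "('a, 'q, 'l) module_scheme" and R :: "('a, 'r, 'o) module_scheme"
  assumes KA: "algebra K A" and AQ: "module A Q" and AR: "module A R"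
begin

interpretation A: cring A using KA by (rule algebra.M_cring)
interpretation KA: algebra K A by (rule KA)
interpretation Q: module A Q by (rule AQ)
interpretation R: module A R by (rule AR)

lemma foldr_delta_closed:
  assumes "\<phi> \<in> carrier Q \<rightarrow> carrier R" "set as \<subseteq> carrier A"
  shows "foldr (delta Q R) as \<phi> \<in> carrier Q \<rightarrow> carrier R"
  using assms(2)
  by (induction as) (use assms(1) in \<open>auto simp: delta_def Pi_def\<close>)

lemma foldr_delta_add:
  assumes "\<phi> \<in> carrier Q \<rightarrow> carrier R" "\<psi> \<in> carrier Q \<rightarrow> carrier R"
    and "set as \<subseteq> carrier A" "x \<in> carrier Q"
  shows "foldr (delta Q R) as (\<lambda>x\<in>carrier Q. \<phi> x \<oplus>\<^bsub>R\<^esub> \<psi> x) x =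
    foldr (delta Q R) as \<phi> x \<oplus>\<^bsub>R\<^esub> foldr (delta Q R) as \<psi> x"
  using assms(3,4)
proof (induction as arbitrary: x)
  case (Cons a as)
  note c = foldr_delta_closed[OF assms(1), of as, THEN funcset_mem]
    foldr_delta_closed[OF assms(2), of as, THEN funcset_mem]
  show ?case
    using Cons
    by (simp add: delta_apply c R.smult_r_distr R.minus_eq R.minus_add R.a_ac del: restrict_apply)
qed simp

lemma foldr_delta_smult:
  assumes "\<phi> \<in> carrier Q \<rightarrow> carrier R" "c \<in> carrier A"
    and "set as \<subseteq> carrier A" "x \<in> carrier Q"
  shows "foldr (delta Q R) as (\<lambda>x\<in>carrier Q. c \<odot>\<^bsub>R\<^esub> \<phi> x) x = c \<odot>\<^bsub>R\<^esub> foldr (delta Q R) as \<phi> x"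
  using assms(3,4)
proof (induction as arbitrary: x)
  case (Cons a as)
  note cl = foldr_delta_closed[OF assms(1), of as, THEN funcset_mem]
  have "a \<odot>\<^bsub>R\<^esub> (c \<odot>\<^bsub>R\<^esub> y) = c \<odot>\<^bsub>R\<^esub> (a \<odot>\<^bsub>R\<^esub> y)" if "y \<in> carrier R" for y
    using Cons.prems assms(2) that by (simp add: R.smult_assoc1[symmetric] A.m_comm)
  then show ?case
    using Cons assms(2)
    by (simp add: delta_apply cl R.smult_r_distr R.minus_eq R.smult_r_minus del: restrict_apply)
qed simp

lemma Diff_add_closed:
  assumes "\<phi> \<in> Diff K A k Q R" "\<psi> \<in> Diff K A k Q R"
  shows "(\<lambda>x\<in>carrier Q. \<phi> x \<oplus>\<^bsub>R\<^esub> \<psi> x) \<in> Diff K A k Q R"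
proof -
  have cl: "\<phi> \<in> carrier Q \<rightarrow> carrier R" "\<psi> \<in> carrier Q \<rightarrow> carrier R"
    using assms by (auto simp: Diff_def linear_maps_restrict_scalars_iff)
  note mem = cl[THEN funcset_mem]
  have "(\<lambda>x\<in>carrier Q. \<phi> x \<oplus>\<^bsub>R\<^esub> \<psi> x)
      \<in> linear_maps K (restrict_scalars A Q) (restrict_scalars A R)"
    using assms unfolding Diff_def linear_maps_restrict_scalars_iff
    by (simp add: mem R.smult_r_distr R.M.add.m_ac)
  moreover have "foldr (delta Q R) as (\<lambda>x\<in>carrier Q. \<phi> x \<oplus>\<^bsub>R\<^esub> \<psi> x) x = \<zero>\<^bsub>R\<^esub>"
    if "length as = Suc k" "set as \<subseteq> carrier A" "x \<in> carrier Q" for as x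
    using assms that by (simp only: foldr_delta_add[OF cl]) (simp add: Diff_def)
  ultimately show ?thesis
    by (simp only: Diff_def mem_Collect_eq) blast
qed

lemma Diff_smult_closed:
  assumes "c \<in> carrier A" "\<phi> \<in> Diff K A k Q R"
  shows "(\<lambda>x\<in>carrier Q. c \<odot>\<^bsub>R\<^esub> \<phi> x) \<in> Diff K A k Q R"
proof -
  have "c \<odot>\<^bsub>R\<^esub> (b \<odot>\<^bsub>R\<^esub> y) = b \<odot>\<^bsub>R\<^esub> (c \<odot>\<^bsub>R\<^esub> y)" if "b \<in> carrier A" "y \<in> carrier R" for b y
    using assms(1) that by (simp add: R.smult_assoc1[symmetric] A.m_comm)
  then show ?thesis
    using assms
    by (auto simp: Diff_def linear_maps_restrict_scalars_iff foldr_delta_smult R.smult_r_distr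
        Pi_iff)
qed

lemma Diff_zero: "(\<lambda>x\<in>carrier Q. \<zero>\<^bsub>R\<^esub>) \<in> Diff K A k Q R"
proof -
  have "foldr (delta Q R) as (\<lambda>x\<in>carrier Q. \<zero>\<^bsub>R\<^esub>) x = \<zero>\<^bsub>R\<^esub>"
    if "set as \<subseteq> carrier A" "x \<in> carrier Q" for as x
    using that by (induction as arbitrary: x) (auto simp: delta_def R.minus_eq)
  then show ?thesis
    by (auto simp: Diff_def linear_maps_restrict_scalars_iff)
qed

text \<open>
  The laws hold pointwise in \<open>R\<close>; elements of \<open>Diff\<close> are extensional, so pointwise equality
  suffices. The negative of \<open>\<phi>\<close> is \<open>(- 1) \<cdot> \<phi>\<close>, which makes closure under negation an instance
  of closure under scalars.
\<close>

lemma module_Diff_module: "module A (Diff_module K A k Q R)"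
proof -
  let ?D = "Diff_module K A k Q R"
  have cl: "\<phi> x \<in> carrier R" if "\<phi> \<in> Diff K A k Q R" "x \<in> carrier Q" for \<phi> x
    using that by (auto simp: Diff_def linear_maps_restrict_scalars_iff)
  have eqI: "f = g" if "f \<in> Diff K A k Q R" "g \<in> Diff K A k Q R"
    "\<And>x. x \<in> carrier Q \<Longrightarrow> f x = g x" for f g
    using that by (auto simp: Diff_def linear_maps_restrict_scalars_iff intro: extensionalityI)
  note closed = Diff_add_closed Diff_smult_closed Diff_zero
  have "abelian_group ?D"
  proof (rule abelian_groupI)
    fix \<phi> assume "\<phi> \<in> carrier ?D"
    then have \<phi>: "\<phi> \<in> Diff K A k Q R" by (simp add: Diff_module_def)
    define \<psi> where "\<psi> = (\<lambda>x\<in>carrier Q. (\<ominus>\<^bsub>A\<^esub> \<one>\<^bsub>A\<^esub>) \<odot>\<^bsub>R\<^esub> \<phi> x)"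
    have "\<psi> \<in> Diff K A k Q R" unfolding \<psi>_def using \<phi> by (intro closed) auto
    moreover have "\<psi> x \<oplus>\<^bsub>R\<^esub> \<phi> x = \<zero>\<^bsub>R\<^esub>" if "x \<in> carrier Q" for x
      using that cl[OF \<phi> that] by (simp add: \<psi>_def R.smult_l_minus R.l_neg)
    ultimately show "\<exists>\<psi>\<in>carrier ?D. \<psi> \<oplus>\<^bsub>?D\<^esub> \<phi> = \<zero>\<^bsub>?D\<^esub>"
      using \<phi> by (intro bexI[of _ \<psi>]) (auto simp: Diff_module_def intro!: eqI closed)
  qed (auto simp: Diff_module_def cl R.a_ac simp del: restrict_apply
      simp add: restrict_apply' intro!: eqI closed)
  then show ?thesis
    by (rule moduleI[OF A.is_cring])
      (auto simp: Diff_module_def cl R.smult_l_distr R.smult_r_distr R.smult_assoc1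
        restrict_apply' simp del: restrict_apply intro!: eqI closed)
qed

end


section \<open>Graded commutators of maps supported on the module part\<close>

definition module_part_map ::
  "('k, 'a, 'm) module_scheme \<Rightarrow> ('a, 'p, 'n) module_scheme \<Rightarrow> ('p \<Rightarrow> 'p) \<Rightarrow> 'a \<times> 'p \<Rightarrow> 'a \<times> 'p"
  where "module_part_map A P \<psi> = (\<lambda>x\<in>carrier (diolic A P). (\<zero>\<^bsub>A\<^esub>, \<psi> (snd x)))"

text \<open>
  The map of degree \<open>1\<close> that remains after one commutator with \<open>p \<in> P\<close>: it depends only on
  \<open>\<psi>\<close> along the orbit map \<open>a \<mapsto> a p\<close> of \<open>p\<close>. The sign is that of the subtracted term in
  \<open>\<delta>\<^sub>p\<close>.
\<close>

definition orbit_map ::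
  "('k, 'a, 'm) module_scheme \<Rightarrow> ('a, 'p, 'n) module_scheme \<Rightarrow> 'p \<Rightarrow> ('p \<Rightarrow> 'p) \<Rightarrow>
   'a \<times> 'p \<Rightarrow> 'a \<times> 'p"
  where "orbit_map A P p \<psi> =
    (\<lambda>x\<in>carrier (diolic A P). (\<zero>\<^bsub>A\<^esub>, \<ominus>\<^bsub>P\<^esub> \<psi> (fst x \<odot>\<^bsub>P\<^esub> p)))"

context
  fixes K :: "('k, 'm) ring_scheme" and A :: "('k, 'a, 'n) module_scheme"
    and P :: "('a, 'p, 'l) module_scheme"
  assumes KA: "algebra K A" and AP: "module A P"
begin

interpretation A: cring A using KA by (rule algebra.M_cring)
interpretation KA: algebra K A by (rule KA)
interpretation P: module A P by (rule AP)
interpretation D: algebra K "diolic A P" by (rule diolic_algebra[OF KA AP])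

lemma diolic_minus:
  assumes "a \<in> carrier A" "p \<in> carrier P" "b \<in> carrier A" "q \<in> carrier P"
  shows "(a, p) \<ominus>\<^bsub>diolic A P\<^esub> (b, q) = (a \<ominus>\<^bsub>A\<^esub> b, p \<ominus>\<^bsub>P\<^esub> q)"
proof -
  have "\<ominus>\<^bsub>diolic A P\<^esub> (b, q) = (\<ominus>\<^bsub>A\<^esub> b, \<ominus>\<^bsub>P\<^esub> q)"
    using assms by (intro D.minus_equality) (auto simp: diolic_def A.l_neg P.l_neg)
  then show ?thesis
    by (simp add: a_minus_def) (simp add: diolic_def)
qed

lemma diolic_carrier: "(a, p) \<in> carrier (diolic A P) \<longleftrightarrow> a \<in> carrier A \<and> p \<in> carrier P"
  by (simp add: diolic_def)

lemma diolic_mult: "(a, p) \<otimes>\<^bsub>diolic A P\<^esub> (b, q) = (a \<otimes>\<^bsub>A\<^esub> b, a \<odot>\<^bsub>P\<^esub> q \<oplus>\<^bsub>P\<^esub> b \<odot>\<^bsub>P\<^esub> p)"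
  by (simp add: diolic_def)

lemma diolic_zero: "\<zero>\<^bsub>diolic A P\<^esub> = (\<zero>\<^bsub>A\<^esub>, \<zero>\<^bsub>P\<^esub>)"
  by (simp add: diolic_def)

lemma diolic_add: "(a, p) \<oplus>\<^bsub>diolic A P\<^esub> (b, q) = (a \<oplus>\<^bsub>A\<^esub> b, p \<oplus>\<^bsub>P\<^esub> q)"
  by (simp add: diolic_def)

lemmas diolic_simps = diolic_minus diolic_carrier diolic_mult diolic_zero diolic_add

lemma foldr_delta_zero:
  assumes "\<psi> \<in> carrier P \<rightarrow> carrier P" "\<psi> \<zero>\<^bsub>P\<^esub> = \<zero>\<^bsub>P\<^esub>" "set bs \<subseteq> carrier A"
  shows "foldr (delta P P) bs \<psi> \<zero>\<^bsub>P\<^esub> = \<zero>\<^bsub>P\<^esub>"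
  using assms(3) by (induction bs) (use assms(2) in \<open>auto simp: delta_def P.minus_eq\<close>)

lemma graded_delta_module_part_map:
  assumes "\<psi> \<in> carrier P \<rightarrow> carrier P" "b \<in> carrier A"
  shows "graded_delta (diolic A P) 0 d (b, \<zero>\<^bsub>P\<^esub>) (module_part_map A P \<psi>) =
    module_part_map A P (delta P P b \<psi>)"
proof
  fix x
  show "graded_delta (diolic A P) 0 d (b, \<zero>\<^bsub>P\<^esub>) (module_part_map A P \<psi>) x =
    module_part_map A P (delta P P b \<psi>) x"
  using assms by (cases x) (auto simp: graded_delta_def module_part_map_def delta_def
      diolic_simps Pi_iff A.minus_eq)
qed

text \<open>
  The first product \<open>p \<cdot> (0, \<psi> q)\<close> lies in \<open>P \<cdot> P = 0\<close>, and \<open>\<psi>\<close> sees only the component \<open>a p\<close>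
  of \<open>p \<cdot> (a, q)\<close>.
\<close>

lemma graded_delta_1_module_part_map:
  assumes "\<psi> \<in> carrier P \<rightarrow> carrier P" "p \<in> carrier P"
  shows "graded_delta (diolic A P) 1 0 (\<zero>\<^bsub>A\<^esub>, p) (module_part_map A P \<psi>) = orbit_map A P p \<psi>"
proof
  fix x
  show "graded_delta (diolic A P) 1 0 (\<zero>\<^bsub>A\<^esub>, p) (module_part_map A P \<psi>) x = orbit_map A P p \<psi> x"
  using assms by (cases x) (auto simp: graded_delta_def module_part_map_def orbit_map_def
      diolic_simps Pi_iff A.minus_eq P.minus_eq)
qed

lemma graded_delta_orbit_map:
  assumes "\<psi> \<in> carrier P \<rightarrow> carrier P" "p \<in> carrier P" "b \<in> carrier A"
  shows "graded_delta (diolic A P) 0 d (b, \<zero>\<^bsub>P\<^esub>) (orbit_map A P p \<psi>) =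
    orbit_map A P p (delta P P b \<psi>)"
proof
  fix x
  show "graded_delta (diolic A P) 0 d (b, \<zero>\<^bsub>P\<^esub>) (orbit_map A P p \<psi>) x =
    orbit_map A P p (delta P P b \<psi>) x"
  using assms by (cases x) (auto simp: graded_delta_def orbit_map_def delta_def
      diolic_simps Pi_iff A.minus_eq P.minus_eq P.smult_r_minus P.minus_add P.smult_assoc1)
qed

lemma graded_delta_1_orbit_map:
  assumes "\<psi> \<in> carrier P \<rightarrow> carrier P" "\<psi> \<zero>\<^bsub>P\<^esub> = \<zero>\<^bsub>P\<^esub>" "p \<in> carrier P" "q \<in> carrier P"
  shows "graded_delta (diolic A P) 1 d (\<zero>\<^bsub>A\<^esub>, q) (orbit_map A P p \<psi>) =
    (\<lambda>x\<in>carrier (diolic A P). \<zero>\<^bsub>diolic A P\<^esub>)"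
proof
  fix x
  show "graded_delta (diolic A P) 1 d (\<zero>\<^bsub>A\<^esub>, q) (orbit_map A P p \<psi>) x =
    (\<lambda>x\<in>carrier (diolic A P). \<zero>\<^bsub>diolic A P\<^esub>) x"
  using assms by (cases x) (auto simp: graded_delta_def orbit_map_def
      diolic_simps Pi_iff A.minus_eq P.minus_eq)
qed

text \<open>
  The components of the grading outside degrees \<open>0\<close> and \<open>1\<close> still contain the element \<open>0\<close>, so
  lists of homogeneous elements may contain it in any degree.
\<close>

lemma graded_delta_by_zero:
  assumes "\<chi> \<in> carrier (diolic A P) \<rightarrow> carrier (diolic A P)" "\<chi> \<zero>\<^bsub>diolic A P\<^esub> = \<zero>\<^bsub>diolic A P\<^esub>"
  shows "graded_delta (diolic A P) i d \<zero>\<^bsub>diolic A P\<^esub> \<chi> =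
    (\<lambda>x\<in>carrier (diolic A P). \<zero>\<^bsub>diolic A P\<^esub>)"
  using assms by (auto simp: graded_delta_def D.minus_eq Pi_iff)

lemma graded_delta_of_zero:
  assumes "a \<in> carrier (diolic A P)"
  shows "graded_delta (diolic A P) i d a (\<lambda>x\<in>carrier (diolic A P). \<zero>\<^bsub>diolic A P\<^esub>) =
    (\<lambda>x\<in>carrier (diolic A P). \<zero>\<^bsub>diolic A P\<^esub>)"
  using assms by (auto simp: graded_delta_def D.minus_eq)

lemma module_part_map_pointed:
  assumes "\<psi> \<in> carrier P \<rightarrow> carrier P" "\<psi> \<zero>\<^bsub>P\<^esub> = \<zero>\<^bsub>P\<^esub>"
  shows "module_part_map A P \<psi> \<in> carrier (diolic A P) \<rightarrow> carrier (diolic A P)"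
    and "module_part_map A P \<psi> \<zero>\<^bsub>diolic A P\<^esub> = \<zero>\<^bsub>diolic A P\<^esub>"
  using assms by (auto simp: module_part_map_def diolic_simps)

lemma orbit_map_pointed:
  assumes "\<psi> \<in> carrier P \<rightarrow> carrier P" "\<psi> \<zero>\<^bsub>P\<^esub> = \<zero>\<^bsub>P\<^esub>" "p \<in> carrier P"
  shows "orbit_map A P p \<psi> \<in> carrier (diolic A P) \<rightarrow> carrier (diolic A P)"
    and "orbit_map A P p \<psi> \<zero>\<^bsub>diolic A P\<^esub> = \<zero>\<^bsub>diolic A P\<^esub>"
  using assms by (auto simp: orbit_map_def diolic_simps Pi_iff)

lemma graded_deltas_innermost_1:
  assumes "\<psi> \<in> carrier P \<rightarrow> carrier P" "p \<in> carrier P" "set bs \<subseteq> carrier A"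
  shows "graded_deltas (diolic A P) 0 (map (\<lambda>b. (0, (b, \<zero>\<^bsub>P\<^esub>))) bs @ [(1, (\<zero>\<^bsub>A\<^esub>, p))])
      (module_part_map A P \<psi>) = orbit_map A P p (foldr (delta P P) bs \<psi>)"
  using assms(3)
  by (induction bs) (simp_all add: graded_delta_1_module_part_map graded_delta_orbit_map
      foldr_delta_closed[OF KA AP AP] assms(1,2))

text \<open>
  The three cases correspond to no, one, or at least two entries of degree \<open>1\<close>; a zero entry
  in any other degree also leads to the last one. The list \<open>bs\<close> collects the entries from \<open>A\<close>. In the first case the
  total degree is recorded because it is the sign exponent of the next commutator, which must
  be even for a commutator with \<open>p \<in> P\<close> to produce the sign in \<open>orbit_map\<close>.
\<close>

lemma graded_deltas_module_part_map:
  assumes \<psi>: "\<psi> \<in> carrier P \<rightarrow> carrier P" "\<psi> \<zero>\<^bsub>P\<^esub> = \<zero>\<^bsub>P\<^esub>"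
    and "\<forall>(i, a)\<in>set as. a \<in> diolic_grading A P i"
  defines "\<chi> \<equiv> graded_deltas (diolic A P) 0 as (module_part_map A P \<psi>)"
  shows "(\<exists>bs. set bs \<subseteq> carrier A \<and> length bs = length as \<and> sum_list (map fst as) = 0 \<and>
        \<chi> = module_part_map A P (foldr (delta P P) bs \<psi>))
    \<or> (\<exists>bs p. set bs \<subseteq> carrier A \<and> p \<in> carrier P \<and> Suc (length bs) = length as \<and>
        \<chi> = orbit_map A P p (foldr (delta P P) bs \<psi>))
    \<or> \<chi> = (\<lambda>x\<in>carrier (diolic A P). \<zero>\<^bsub>diolic A P\<^esub>)"
  using assms(3) unfolding \<chi>_def
proof (induction as)
  case Nil
  then show ?case by (auto intro: exI[of _ "[]"])
next
  case (Cons ia as)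
  obtain i a where ia: "ia = (i, a)" by (cases ia)
  let ?s = "sum_list (map fst as)"
  let ?\<chi> = "graded_deltas (diolic A P) 0 as (module_part_map A P \<psi>)"
  let ?Z = "\<lambda>x\<in>carrier (diolic A P). \<zero>\<^bsub>diolic A P\<^esub>"
  have step: "graded_deltas (diolic A P) 0 (ia # as) (module_part_map A P \<psi>) =
      graded_delta (diolic A P) i ?s a ?\<chi>"
    by (simp add: ia)
  have a: "a \<in> diolic_grading A P i" using Cons.prems by (simp add: ia)
  then have aD: "a \<in> carrier (diolic A P)"
    by (auto simp: diolic_grading_def diolic_simps split: if_splits)
  note cl = foldr_delta_closed[OF KA AP AP \<psi>(1)] and z = foldr_delta_zero[OF \<psi>]
  have "\<forall>(i, a)\<in>set as. a \<in> diolic_grading A P i" using Cons.prems by simp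
  from Cons.IH[OF this] consider
    (part) bs where "set bs \<subseteq> carrier A" "length bs = length as" "?s = 0"
      "?\<chi> = module_part_map A P (foldr (delta P P) bs \<psi>)"
  | (orbit) bs p where "set bs \<subseteq> carrier A" "p \<in> carrier P" "Suc (length bs) = length as"
      "?\<chi> = orbit_map A P p (foldr (delta P P) bs \<psi>)"
  | (zero) "?\<chi> = ?Z"
    by blast
  then show ?case
  proof cases
    case part
    note pointed = module_part_map_pointed[OF cl z, OF part(1) part(1)]
    consider (0) b where "i = 0" "b \<in> carrier A" "a = (b, \<zero>\<^bsub>P\<^esub>)"
      | (1) p where "i = 1" "p \<in> carrier P" "a = (\<zero>\<^bsub>A\<^esub>, p)"
      | (other) "a = \<zero>\<^bsub>diolic A P\<^esub>"
      using a by (auto simp: diolic_grading_def diolic_zero split: if_splits)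
    then show ?thesis
    proof cases
      case 0
      then have "graded_delta (diolic A P) i ?s a ?\<chi> =
          module_part_map A P (foldr (delta P P) (b # bs) \<psi>)"
        using part cl by (simp add: graded_delta_module_part_map)
      then show ?thesis
        unfolding step using 0 part by (intro disjI1 exI[of _ "b # bs"]) (auto simp: ia)
    next
      case 1
      then have "graded_delta (diolic A P) i ?s a ?\<chi> = orbit_map A P p (foldr (delta P P) bs \<psi>)"
        using part cl by (simp add: graded_delta_1_module_part_map)
      then show ?thesis
        unfolding step using 1 part
        by (intro disjI2 disjI1 exI[of _ bs] exI[of _ p]) auto
    next
      case other
      then show ?thesis
        unfolding step part(4) using graded_delta_by_zero[OF pointed] by simp
    qed
  next
    case orbit
    note pointed = orbit_map_pointed[OF cl z, OF orbit(1) orbit(1) orbit(2)]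
    consider (0) b where "i = 0" "b \<in> carrier A" "a = (b, \<zero>\<^bsub>P\<^esub>)"
      | (1) q where "i = 1" "q \<in> carrier P" "a = (\<zero>\<^bsub>A\<^esub>, q)"
      | (other) "a = \<zero>\<^bsub>diolic A P\<^esub>"
      using a by (auto simp: diolic_grading_def diolic_zero split: if_splits)
    then show ?thesis
    proof cases
      case 0
      then have "graded_delta (diolic A P) i ?s a ?\<chi> = orbit_map A P p (foldr (delta P P) (b # bs) \<psi>)"
        using orbit cl by (simp add: graded_delta_orbit_map)
      then show ?thesis
        unfolding step using 0 orbit
        by (intro disjI2 disjI1 exI[of _ "b # bs"] exI[of _ p]) auto
    next
      case 1
      then have "graded_delta (diolic A P) i ?s a ?\<chi> = ?Z"
        using orbit cl z by (simp add: graded_delta_1_orbit_map)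
      then show ?thesis unfolding step by simp
    next
      case other
      then show ?thesis
        unfolding step orbit(4) using graded_delta_by_zero[OF pointed] by simp
    qed
  next
    case zero
    show ?thesis unfolding step zero using graded_delta_of_zero[OF aD] by simp
  qed
qed


section \<open>The kernel of the projection\<close>

abbreviation (input) "linear_endos \<equiv> linear_maps K (restrict_scalars A P) (restrict_scalars A P)"

lemma linear_pointed:
  assumes "\<psi> \<in> linear_endos"
  shows "\<psi> \<in> carrier P \<rightarrow> carrier P" "\<psi> \<zero>\<^bsub>P\<^esub> = \<zero>\<^bsub>P\<^esub>"
proof -
  show cl: "\<psi> \<in> carrier P \<rightarrow> carrier P"
    using assms by (simp add: linear_maps_restrict_scalars_iff)
  have "\<psi> (\<zero>\<^bsub>P\<^esub> \<oplus>\<^bsub>P\<^esub> \<zero>\<^bsub>P\<^esub>) = \<psi> \<zero>\<^bsub>P\<^esub> \<oplus>\<^bsub>P\<^esub> \<psi> \<zero>\<^bsub>P\<^esub>"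
    using assms unfolding linear_maps_restrict_scalars_iff by blast
  then show "\<psi> \<zero>\<^bsub>P\<^esub> = \<zero>\<^bsub>P\<^esub>"
    using funcset_mem[OF cl P.zero_closed] by (simp add: P.M.add.l_cancel_one')
qed

lemma module_part_map_graded:
  assumes "\<psi> \<in> linear_endos"
  shows "module_part_map A P \<psi> \<in> graded_maps K (diolic A P) (diolic_grading A P) 0"
proof -
  note \<psi> = linear_pointed[OF assms]
  have cl: "\<psi> p \<in> carrier P" if "p \<in> carrier P" for p
    using \<psi>(1) that by blast
  have "is_linear K (diolic A P) (diolic A P) (module_part_map A P \<psi>)"
    using assms unfolding is_linear_def linear_maps_restrict_scalars_iff
    by (auto simp: module_part_map_def diolic_def cl)
  then have "module_part_map A P \<psi> \<in> linear_maps K (diolic A P) (diolic A P)"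
    by (simp add: linear_maps_def module_part_map_def)
  moreover have "module_part_map A P \<psi> x \<in> diolic_grading A P i"
    if "x \<in> diolic_grading A P i" for i x
    using that
    by (cases x) (simp add: module_part_map_def diolic_grading_def diolic_simps \<psi>(2) cl
        split: if_splits)
  ultimately show ?thesis
    by (simp add: graded_maps_def image_subset_iff)
qed

text \<open>
  Of \<open>m + 2\<close> commutators one may be spent on an element of \<open>P\<close>, and the other \<open>m + 1\<close> are what
  order \<open>\<le> m\<close> of \<open>\<psi>\<close> controls.
\<close>

lemma module_part_map_graded_Diff_iff:
  assumes "\<psi> \<in> linear_endos"
  shows "module_part_map A P \<psi> \<in> graded_Diff K (diolic A P) (diolic_grading A P) (Suc m) 0
    \<longleftrightarrow> \<psi> \<in> Diff K A m P P"
proof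
  note \<psi> = linear_pointed[OF assms]
  note cl = foldr_delta_closed[OF KA AP AP \<psi>(1)]
  assume *: "module_part_map A P \<psi> \<in> graded_Diff K (diolic A P) (diolic_grading A P) (Suc m) 0"
  have "foldr (delta P P) bs \<psi> p = \<zero>\<^bsub>P\<^esub>"
    if bs: "length bs = Suc m" "set bs \<subseteq> carrier A" and p: "p \<in> carrier P" for bs p
  proof -
    \<comment> \<open>Every \<open>p\<close> is the value of its orbit map at the unit of \<open>A\<close>.\<close>
    let ?as = "map (\<lambda>b. (0::int, (b, \<zero>\<^bsub>P\<^esub>))) bs @ [(1, (\<zero>\<^bsub>A\<^esub>, p))]"
    have "length ?as = Suc (Suc m)" "\<forall>(i, a)\<in>set ?as. a \<in> diolic_grading A P i"
      "(\<one>\<^bsub>A\<^esub>, \<zero>\<^bsub>P\<^esub>) \<in> carrier (diolic A P)"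
      using bs p by (auto simp: diolic_grading_def diolic_simps)
    then have "graded_deltas (diolic A P) 0 ?as (module_part_map A P \<psi>) (\<one>\<^bsub>A\<^esub>, \<zero>\<^bsub>P\<^esub>) =
        \<zero>\<^bsub>diolic A P\<^esub>"
      using * unfolding graded_Diff_def by blast
    then have "\<ominus>\<^bsub>P\<^esub> foldr (delta P P) bs \<psi> p = \<zero>\<^bsub>P\<^esub>"
      using p by (simp add: graded_deltas_innermost_1[OF \<psi>(1) p bs(2)] orbit_map_def diolic_simps)
    then show ?thesis
      using P.r_neg[OF funcset_mem[OF cl[OF bs(2)] p]] funcset_mem[OF cl[OF bs(2)] p] by simp
  qed
  then show "\<psi> \<in> Diff K A m P P"
    using assms by (simp add: Diff_def)
next
  note \<psi> = linear_pointed[OF assms]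
  assume "\<psi> \<in> Diff K A m P P"
  then have D: "foldr (delta P P) bs \<psi> p = \<zero>\<^bsub>P\<^esub>"
    if "length bs = Suc m" "set bs \<subseteq> carrier A" "p \<in> carrier P" for bs p
    using that by (simp add: Diff_def)
  have "graded_deltas (diolic A P) 0 as (module_part_map A P \<psi>) x = \<zero>\<^bsub>diolic A P\<^esub>"
    if as: "length as = Suc (Suc m)" "\<forall>(i, a)\<in>set as. a \<in> diolic_grading A P i"
      and x: "x \<in> carrier (diolic A P)" for as x
    using graded_deltas_module_part_map[OF \<psi> as(2)]
  proof (elim disjE exE conjE)
    fix bs
    assume bs: "set bs \<subseteq> carrier A" "length bs = length as"
      and eq: "graded_deltas (diolic A P) 0 as (module_part_map A P \<psi>) =
        module_part_map A P (foldr (delta P P) bs \<psi>)"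
    \<comment> \<open>Here there is one commutator more than needed; the outermost one preserves zero.\<close>
    obtain b bs' where "bs = b # bs'" "length bs' = Suc m" "b \<in> carrier A" "set bs' \<subseteq> carrier A"
      using bs as(1) by (cases bs) auto
    then have "foldr (delta P P) bs \<psi> p = \<zero>\<^bsub>P\<^esub>" if "p \<in> carrier P" for p
      using that by (simp add: delta_def D P.minus_eq)
    then show ?thesis
      unfolding eq using x by (cases x) (simp add: module_part_map_def diolic_simps)
  next
    fix bs p
    assume bs: "set bs \<subseteq> carrier A" "p \<in> carrier P" "Suc (length bs) = length as"
      and eq: "graded_deltas (diolic A P) 0 as (module_part_map A P \<psi>) =
        orbit_map A P p (foldr (delta P P) bs \<psi>)"
    then show ?thesis
      unfolding eq using x as(1) by (cases x) (simp add: orbit_map_def diolic_simps D)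
  next
    assume "graded_deltas (diolic A P) 0 as (module_part_map A P \<psi>) =
      (\<lambda>x\<in>carrier (diolic A P). \<zero>\<^bsub>diolic A P\<^esub>)"
    then show ?thesis using x by simp
  qed
  then show "module_part_map A P \<psi> \<in> graded_Diff K (diolic A P) (diolic_grading A P) (Suc m) 0"
    using module_part_map_graded[OF assms] by (simp add: graded_Diff_def)
qed

lemma varsigma_zero_imp_module_part_map:
  assumes \<phi>: "\<phi> \<in> graded_maps K (diolic A P) (diolic_grading A P) 0"
    and ker: "\<And>a. a \<in> carrier A \<Longrightarrow> varsigma A P \<phi> a = \<zero>\<^bsub>A\<^esub>"
  obtains \<psi> where "\<psi> \<in> linear_endos" "\<phi> = module_part_map A P \<psi>"
proof
  define \<psi> where "\<psi> = (\<lambda>p\<in>carrier P. snd (\<phi> (\<zero>\<^bsub>A\<^esub>, p)))"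
  have lin: "is_linear K (diolic A P) (diolic A P) \<phi>" and ext: "\<phi> \<in> extensional (carrier (diolic A P))"
    and gr: "\<And>i x. x \<in> diolic_grading A P i \<Longrightarrow> \<phi> x \<in> diolic_grading A P i"
    using \<phi> by (auto simp: graded_maps_def linear_maps_def)
  have add: "\<phi> (x \<oplus>\<^bsub>diolic A P\<^esub> y) = \<phi> x \<oplus>\<^bsub>diolic A P\<^esub> \<phi> y"
    if "x \<in> carrier (diolic A P)" "y \<in> carrier (diolic A P)" for x y
    using lin that unfolding is_linear_def by blast
  have smult: "\<phi> (c \<odot>\<^bsub>diolic A P\<^esub> x) = c \<odot>\<^bsub>diolic A P\<^esub> \<phi> x"
    if "c \<in> carrier K" "x \<in> carrier (diolic A P)" for c x
    using lin that unfolding is_linear_def by blast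
  have on_A: "\<phi> (a, \<zero>\<^bsub>P\<^esub>) = (\<zero>\<^bsub>A\<^esub>, \<zero>\<^bsub>P\<^esub>)" if "a \<in> carrier A" for a
    using that ker[OF that] gr[of "(a, \<zero>\<^bsub>P\<^esub>)" 0]
    by (auto simp: varsigma_def diolic_grading_def)
  have on_P: "\<phi> (\<zero>\<^bsub>A\<^esub>, p) = (\<zero>\<^bsub>A\<^esub>, \<psi> p)" and cl: "\<psi> p \<in> carrier P" if "p \<in> carrier P" for p
    using that gr[of "(\<zero>\<^bsub>A\<^esub>, p)" 1] by (auto simp: \<psi>_def diolic_grading_def)
  have "\<psi> (p \<oplus>\<^bsub>P\<^esub> q) = \<psi> p \<oplus>\<^bsub>P\<^esub> \<psi> q" if "p \<in> carrier P" "q \<in> carrier P" for p q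
    using add[of "(\<zero>\<^bsub>A\<^esub>, p)" "(\<zero>\<^bsub>A\<^esub>, q)"] that by (simp add: diolic_simps on_P)
  moreover have "\<psi> ((c \<odot>\<^bsub>A\<^esub> \<one>\<^bsub>A\<^esub>) \<odot>\<^bsub>P\<^esub> p) = (c \<odot>\<^bsub>A\<^esub> \<one>\<^bsub>A\<^esub>) \<odot>\<^bsub>P\<^esub> \<psi> p"
    if "c \<in> carrier K" "p \<in> carrier P" for c p
    using smult[of c "(\<zero>\<^bsub>A\<^esub>, p)"] that by (simp add: diolic_def on_P)
  ultimately show "\<psi> \<in> linear_endos"
    using cl by (auto simp: linear_maps_restrict_scalars_iff) (simp add: \<psi>_def)
  show "\<phi> = module_part_map A P \<psi>"
  proof (rule extensionalityI[OF ext])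
    show "module_part_map A P \<psi> \<in> extensional (carrier (diolic A P))"
      by (simp add: module_part_map_def)
    fix x assume "x \<in> carrier (diolic A P)"
    then show "\<phi> x = module_part_map A P \<psi> x"
      using add[of "(fst x, \<zero>\<^bsub>P\<^esub>)" "(\<zero>\<^bsub>A\<^esub>, snd x)"]
      by (cases x) (simp add: diolic_simps on_A on_P cl module_part_map_def)
  qed
qed

lemma ker_varsigma_carrier:
  "carrier (ker_varsigma K A P (Suc m)) = module_part_map A P ` Diff K A m P P"
proof -
  have k: "\<phi> \<in> carrier (ker_varsigma K A P (Suc m)) \<longleftrightarrow>
      \<phi> \<in> graded_Diff K (diolic A P) (diolic_grading A P) (Suc m) 0 \<and>
      varsigma A P \<phi> = (\<lambda>a\<in>carrier A. \<zero>\<^bsub>A\<^esub>)" for \<phi>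
    by (simp add: ker_varsigma_def a_kernel_def' diolic_Diff0_def Diff_module_def self_module_def)
  show ?thesis
  proof (intro equalityI subsetI)
    fix \<phi> assume \<phi>: "\<phi> \<in> carrier (ker_varsigma K A P (Suc m))"
    then have "\<phi> \<in> graded_maps K (diolic A P) (diolic_grading A P) 0"
      "\<And>a. a \<in> carrier A \<Longrightarrow> varsigma A P \<phi> a = \<zero>\<^bsub>A\<^esub>"
      by (auto simp: k graded_Diff_def)
    then obtain \<psi> where "\<psi> \<in> linear_endos" "\<phi> = module_part_map A P \<psi>"
      by (rule varsigma_zero_imp_module_part_map)
    then show "\<phi> \<in> module_part_map A P ` Diff K A m P P"
      using \<phi> by (auto simp: k module_part_map_graded_Diff_iff)
  next
    fix \<phi> assume "\<phi> \<in> module_part_map A P ` Diff K A m P P"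
    then obtain \<psi> where \<psi>: "\<psi> \<in> Diff K A m P P" "\<phi> = module_part_map A P \<psi>" by auto
    then have "\<psi> \<in> linear_endos" by (simp add: Diff_def)
    moreover have "varsigma A P \<phi> = (\<lambda>a\<in>carrier A. \<zero>\<^bsub>A\<^esub>)"
      by (auto simp: \<psi> varsigma_def module_part_map_def diolic_simps)
    ultimately show "\<phi> \<in> carrier (ker_varsigma K A P (Suc m))"
      using \<psi> by (simp add: k module_part_map_graded_Diff_iff)
  qed
qed

lemma inj_on_module_part_map: "inj_on (module_part_map A P) (extensional (carrier P))"
proof (rule inj_onI)
  fix \<psi> \<psi>' assume ext: "\<psi> \<in> extensional (carrier P)" "\<psi>' \<in> extensional (carrier P)"
    and eq: "module_part_map A P \<psi> = module_part_map A P \<psi>'"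
  show "\<psi> = \<psi>'"
  proof (rule extensionalityI[OF ext])
    fix p assume "p \<in> carrier P"
    then show "\<psi> p = \<psi>' p"
      using fun_cong[OF eq, of "(\<zero>\<^bsub>A\<^esub>, p)"] by (simp add: module_part_map_def diolic_simps)
  qed
qed

lemma ker_varsigma_isomorphic:
  "module_isomorphic A (ker_varsigma K A P (Suc m)) (Diff_module K A m P P)"
proof (rule module_isomorphic_if_bij[where h = "module_part_map A P"])
  let ?N = "Diff_module K A m P P" and ?M = "ker_varsigma K A P (Suc m)"
  show "module A ?N"
    by (rule module_Diff_module[OF KA AP AP])
  have "Diff K A m P P \<subseteq> extensional (carrier P)"
    by (auto simp: Diff_def linear_maps_restrict_scalars_iff)
  then have "inj_on (module_part_map A P) (Diff K A m P P)"
    by (rule inj_on_subset[OF inj_on_module_part_map])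
  then show "bij_betw (module_part_map A P) (carrier ?N) (carrier ?M)"
    unfolding bij_betw_def ker_varsigma_carrier by (simp add: Diff_module_def)
  have cl: "\<psi> p \<in> carrier P" if "\<psi> \<in> carrier ?N" "p \<in> carrier P" for \<psi> p
    using that by (auto simp: Diff_module_def Diff_def linear_maps_restrict_scalars_iff)
  show "module_part_map A P (\<psi> \<oplus>\<^bsub>?N\<^esub> \<psi>') = module_part_map A P \<psi> \<oplus>\<^bsub>?M\<^esub> module_part_map A P \<psi>'"
    for \<psi> \<psi>'
    by (auto simp: ker_varsigma_def diolic_Diff0_def Diff_module_def module_part_map_def diolic_simps)
  show "module_part_map A P (c \<odot>\<^bsub>?N\<^esub> \<psi>) = c \<odot>\<^bsub>?M\<^esub> module_part_map A P \<psi>"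
    if "c \<in> carrier A" "\<psi> \<in> carrier ?N" for c \<psi>
    using that(1) cl[OF that(2)]
    by (auto simp: ker_varsigma_def diolic_Diff0_def Diff_module_def module_part_map_def diolic_simps)
  show "module_part_map A P \<zero>\<^bsub>?N\<^esub> = \<zero>\<^bsub>?M\<^esub>"
    by (auto simp: ker_varsigma_def diolic_Diff0_def Diff_module_def module_part_map_def diolic_simps)
qed

end

theorem lemma32:
  fixes K :: "('k, 'm) ring_scheme"
    and A :: "('k, 'a, 'n) module_scheme"
    and P :: "('a, 'p, 'l) module_scheme"
    and k :: nat
  assumes "field K" and "char_zero K"
    and "algebra K A"
    and "module A P"
    and "k \<ge> 1"
  shows "module_isomorphic A (ker_varsigma K A P k) (Diff_module K A (k - 1) P P)"
  using ker_varsigma_isomorphic[OF assms(3,4), of "k - 1"] assms(5) by simp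

end
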